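(* Let $n,d\in\mathbb{N}$ be such that $d$ and $n/(2d)\ge 2$ are even integers, and let $M:=(n/d)^{d/2}$. Then there exist a polytope $\mathcal{P}\subseteq\mathbb{R}^d$ with $n/2$ facets and $M$ vertices, and an orthogonal projection $\Pi\colon\mathbb{R}^d\to\mathbb{R}^2$, such that \[ \Pi(\mathcal{P})=\operatorname{conv}\left\{\left(\tfrac{t}{M-1},\ \left(\tfrac{t}{M-1}\right)^2-\tfrac{t}{M-1}\right)\colon t\in\{0,1,\ldots,M-1\}\right\}. \] *)

theory Defs
  imports "HOL-Analysis.Analysis"
begin

(* An orthogonal projection with values in another Euclidean space: project orthogonally onto
   a linear subspace U (for a subspace, the nearest point is the foot of the perpendicular), then
   identify U isometrically with the target space; in particular U has the dimension of the
   target. Coordinate projections are the special case where coordinate vectors span U. *)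
definition orthogonal_projection :: "('a::euclidean_space \<Rightarrow> 'b::euclidean_space) \<Rightarrow> bool" where
  "orthogonal_projection f \<longleftrightarrow>
     (\<exists>U \<phi>. subspace U \<and> linear \<phi> \<and> (\<forall>u\<in>U. norm (\<phi> u) = norm u) \<and> \<phi> ` U = UNIV \<and>
            (\<forall>x. f x = \<phi> (closest_point U x)))"

end

theory Submission
  imports Defs
begin

text \<open>
  Put \<open>N = n/d\<close> and \<open>k = d/2\<close>. Write \<open>t < N^k\<close> in the reflected base-\<open>N\<close> code: \<open>\<rho>\<^sub>0 = 0\<close> and, with
  \<open>K = N^i\<close>, either \<open>\<rho>\<^sub>i\<^sub>+\<^sub>1 = b K + \<rho>\<^sub>i\<close> (\<open>b\<close> even) or \<open>\<rho>\<^sub>i\<^sub>+\<^sub>1 = (b + 1) K - 1 - \<rho>\<^sub>i\<close> (\<open>b\<close> odd), with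
  \<open>\<rho>\<^sub>k = t\<close>. The polytope is the convex hull of the points \<open>(\<rho>\<^sub>i, \<rho>\<^sub>i\<^sup>2)\<close>, \<open>1 \<le> i \<le> k\<close>, in \<open>\<real>\<^sup>2\<^sup>k\<close>. Its
  projection to the last pair of coordinates consists of points on a parabola, so all \<open>N^k\<close> points
  are vertices. For fixed lower levels, the \<open>N\<close> possible points of level \<open>i + 1\<close> form a polygon; an
  edge of it joins two points of the parabola whose abscissae have the constant sum \<open>2 (b + 1) K - 1\<close>
  (or \<open>N K - 1\<close> for the closing edge, as \<open>N\<close> is even). Hence the edge directions are constant and the
  vertices are affine in \<open>(\<rho>\<^sub>i, \<rho>\<^sub>i\<^sup>2)\<close>, so every level contributes \<open>N\<close> linear inequalities: the polytope
  is a deformed product of \<open>k\<close> polygons with \<open>N\<close> edges each and has \<open>k N = n/2\<close> facets.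
\<close>

section \<open>Facets of a polyhedron given by an irredundant system of affine inequalities\<close>

lemma affine_functional_combine:
  fixes h :: "'a::real_vector \<Rightarrow> real"
  assumes "linear (\<lambda>x. h x - h 0)" "u + v = 1"
  shows "h (u *\<^sub>R x + v *\<^sub>R y) = u * h x + v * h y"
proof -
  have "h (u *\<^sub>R x + v *\<^sub>R y) - h 0 = (h (u *\<^sub>R x) - h 0) + (h (v *\<^sub>R y) - h 0)"
    by (rule linear_add[OF assms(1)])
  also have "\<dots> = u * (h x - h 0) + v * (h y - h 0)"
    using linear_scale[OF assms(1), of u x] linear_scale[OF assms(1), of v y] by simp
  also have "\<dots> = u * h x + v * h y - (u + v) * h 0"
    by (simp add: algebra_simps)
  finally show ?thesis
    using assms(2) by simp
qed

text \<open>Midpoints combine witnesses: each \<open>h j\<close> is nonnegative at both points and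
  positive at one of them. Applied to a polyhedron and to its faces, this yields a point where all
  the inequalities, or all but one, are strict.\<close>

lemma common_positive_point:
  fixes h :: "'i \<Rightarrow> 'a::real_vector \<Rightarrow> real"
  assumes "finite J" "convex C" "C \<noteq> {}"
    and lin: "\<And>j. j \<in> J \<Longrightarrow> linear (\<lambda>x. h j x - h j 0)"
    and nonneg: "\<And>j x. j \<in> J \<Longrightarrow> x \<in> C \<Longrightarrow> h j x \<ge> 0"
    and pos: "\<And>j. j \<in> J \<Longrightarrow> \<exists>x\<in>C. h j x > 0"
  shows "\<exists>x\<in>C. \<forall>j\<in>J. h j x > 0"
  using assms(1) lin nonneg pos
proof (induction J rule: finite_induct)
  case empty
  then show ?case using \<open>C \<noteq> {}\<close> by auto
next
  case (insert i J)
  obtain x where x: "x \<in> C" "\<forall>j\<in>J. h j x > 0"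
    using insert.IH insert.prems by auto
  obtain y where y: "y \<in> C" "h i y > 0"
    using insert.prems(3) by auto
  let ?z = "(1/2) *\<^sub>R x + (1/2) *\<^sub>R y"
  have "?z \<in> C"
    using \<open>convex C\<close> x y by (intro convexD) auto
  moreover have "h j ?z > 0" if "j \<in> insert i J" for j
  proof -
    have "h j ?z = (1/2) * h j x + (1/2) * h j y"
      by (rule affine_functional_combine) (use insert.prems(1) that in auto)
    moreover have "h j x \<ge> 0" "h j y \<ge> 0"
      using insert.prems(2) that x y by auto
    moreover have "h j x > 0 \<or> h j y > 0"
      using that x y by auto
    ultimately show ?thesis by linarith
  qed
  ultimately show ?case by blast
qed

text \<open>Moving from a point \<open>w\<close> with all inequalities strict through a point
  \<open>q i\<close> where only the \<open>i\<close>-th is tight, and slightly beyond, violates that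
  inequality alone. Hence none is redundant, and each one cuts out a facet; the points
  \<open>q i\<close> also tell the facets apart.\<close>

lemma card_facets_irredundant:
  fixes h :: "'i \<Rightarrow> 'a::euclidean_space \<Rightarrow> real"
  assumes "finite I"
    and P: "P = {x. \<forall>i\<in>I. h i x \<ge> 0}" and "P \<noteq> {}"
    and lin: "\<And>i. i \<in> I \<Longrightarrow> linear (\<lambda>x. h i x - h i 0)"
    and pos: "\<And>i. i \<in> I \<Longrightarrow> \<exists>x\<in>P. h i x > 0"
    and zero: "\<And>i. i \<in> I \<Longrightarrow> \<exists>x\<in>P. h i x = 0"
    and sep: "\<And>i j. i \<in> I \<Longrightarrow> j \<in> I \<Longrightarrow> i \<noteq> j \<Longrightarrow> \<exists>x\<in>P. h i x = 0 \<and> h j x > 0"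
  shows "card {F. F facet_of P} = card I"
proof -
  \<comment> \<open>The adjoint at \<open>1\<close> represents the linear part of \<open>h i\<close>
    as an inner product; the sign makes \<open>a i\<close> an outer normal.\<close>
  define a where "a i = - adjoint (\<lambda>x. h i x - h i 0) 1" for i
  have h: "h i x = h i 0 - a i \<bullet> x" if "i \<in> I" for i x
    using adjoint_works[OF lin[OF that], of x 1] by (simp add: a_def inner_commute)
  have cvx: "convex P"
  proof (rule convexI)
    fix x y and u v :: real
    assume *: "x \<in> P" "y \<in> P" "0 \<le> u" "0 \<le> v" "u + v = 1"
    have "h i (u *\<^sub>R x + v *\<^sub>R y) \<ge> 0" if "i \<in> I" for i
      using affine_functional_combine[OF lin[OF that] *(5), of x y] * that by (simp add: P)
    then show "u *\<^sub>R x + v *\<^sub>R y \<in> P" by (simp add: P)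
  qed
  obtain w where w: "w \<in> P" "\<And>i. i \<in> I \<Longrightarrow> h i w > 0"
    using common_positive_point[where h = h, OF \<open>finite I\<close> cvx \<open>P \<noteq> {}\<close> lin _ pos] P by blast
  have "\<exists>q. q \<in> P \<and> h i q = 0 \<and> (\<forall>j\<in>I - {i}. h j q > 0)" if i: "i \<in> I" for i
  proof -
    let ?C = "P \<inter> {x. h i x = 0}"
    have "convex {x. h i x = 0}"
      by (rule convexI) (simp add: affine_functional_combine[OF lin[OF i]])
    then have "convex ?C" using cvx by (simp add: convex_Int)
    moreover have "?C \<noteq> {}" using zero[OF i] by auto
    ultimately have "\<exists>x\<in>?C. \<forall>j\<in>I - {i}. h j x > 0"
      using \<open>finite I\<close> lin sep[OF i] by (intro common_positive_point) (auto simp: P)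
    then show ?thesis by auto
  qed
  then obtain q where q: "\<And>i. i \<in> I \<Longrightarrow> q i \<in> P" "\<And>i. i \<in> I \<Longrightarrow> h i (q i) = 0"
      "\<And>i j. i \<in> I \<Longrightarrow> j \<in> I \<Longrightarrow> i \<noteq> j \<Longrightarrow> h j (q i) > 0"
    by (metis Diff_iff singletonD)
  define H where "H i = {x. a i \<bullet> x \<le> h i 0}" for i
  have H: "H i = {x. h i x \<ge> 0}" if "i \<in> I" for i
    unfolding H_def by (subst h[OF that]) auto
  have outside: "\<exists>z. h i z < 0 \<and> (\<forall>j\<in>I - {i}. h j z > 0)" if i: "i \<in> I" for i
  proof -
    \<comment> \<open>push the point \<open>q i\<close> slightly across its facet, away from \<open>w\<close>\<close>
    let ?z = "\<lambda>e::real. (1 + e) *\<^sub>R q i + (- e) *\<^sub>R w"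
    have val: "h j (?z e) = (1 + e) * h j (q i) - e * h j w" if "j \<in> I" for j e
      using affine_functional_combine[OF lin[OF that], of "1 + e" "- e" "q i" w] by simp
    have "\<forall>\<^sub>F e in at_right 0. h j (?z e) > 0" if "j \<in> I - {i}" for j
    proof -
      have "((\<lambda>e. (1 + e) * h j (q i) - e * h j w) \<longlongrightarrow> (1 + 0) * h j (q i) - 0 * h j w)
          (at_right 0)"
        by (intro tendsto_intros)
      then have "((\<lambda>e. h j (?z e)) \<longlongrightarrow> h j (q i)) (at_right 0)"
        using that val by simp
      moreover have "0 < h j (q i)" using q(3)[OF i, of j] that by auto
      ultimately show ?thesis by (rule order_tendstoD(1))
    qed
    then have "\<forall>\<^sub>F e in at_right (0::real). \<forall>j\<in>I - {i}. h j (?z e) > 0"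
      using \<open>finite I\<close> by (intro eventually_ball_finite) auto
    moreover have "\<forall>\<^sub>F e in at_right (0::real). e > 0"
      by (rule eventually_at_right_less)
    ultimately have "\<forall>\<^sub>F e in at_right (0::real). e > 0 \<and> (\<forall>j\<in>I - {i}. h j (?z e) > 0)"
      by (rule eventually_conj[rotated])
    then obtain e :: real where e: "e > 0" "\<forall>j\<in>I - {i}. h j (?z e) > 0"
      using eventually_happens'[of "at_right (0::real)"] by auto
    moreover have "h i (?z e) < 0"
      using val[OF i, of e] q(2)[OF i] w(2)[OF i] e(1) by simp
    ultimately show ?thesis by blast
  qed
  have inj: "inj_on H I"
  proof (rule inj_onI, rule ccontr)
    fix i j assume *: "i \<in> I" "j \<in> I" "H i = H j" "i \<noteq> j"
    obtain z where "h i z < 0" "h j z > 0" using outside[OF \<open>i \<in> I\<close>] * by blast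
    moreover have "z \<in> H i \<longleftrightarrow> h i z \<ge> 0" "z \<in> H j \<longleftrightarrow> h j z \<ge> 0"
      using H * by auto
    ultimately show False using \<open>H i = H j\<close> by auto
  qed
  have op: "open (\<Inter>i\<in>I. {x. a i \<bullet> x < h i 0})"
    using \<open>finite I\<close> by (auto simp: open_halfspace_lt)
  have sub: "(\<Inter>i\<in>I. {x. a i \<bullet> x < h i 0}) \<subseteq> P"
  proof
    fix x assume "x \<in> (\<Inter>i\<in>I. {x. a i \<bullet> x < h i 0})"
    then have "h i x \<ge> 0" if "i \<in> I" for i
      using h[OF that, of x] that by fastforce
    then show "x \<in> P" by (simp add: P)
  qed
  have "w \<in> (\<Inter>i\<in>I. {x. a i \<bullet> x < h i 0})"
    using w(2) h[of _ w] by fastforce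
  then have "w \<in> interior P"
    by (rule interiorI[OF op _ sub])
  then have "interior P \<noteq> {}" by blast
  then have aff: "affine hull P = UNIV"
    by (rule affine_hull_nonempty_interior)
  \<comment> \<open>The explicit description of facets is indexed by halfspaces rather than by
    \<open>I\<close>, so normals and offsets are transported along the inverse of
    \<open>H\<close>.\<close>
  define a' where "a' C = a (the_inv_into I H C)" for C
  define b' where "b' C = h (the_inv_into I H C) 0" for C
  have inv: "the_inv_into I H (H i) = i" if "i \<in> I" for i
    using inj that by (rule the_inv_into_f_f)
  have PH: "P = affine hull P \<inter> \<Inter>(H ` I)"
    unfolding aff using H by (auto simp: P)
  have facet: "C facet_of P \<longleftrightarrow> (\<exists>D. D \<in> H ` I \<and> C = P \<inter> {x. a' D \<bullet> x = b' D})" for C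
  proof (rule facet_of_polyhedron_explicit[OF _ PH])
    show "finite (H ` I)" using \<open>finite I\<close> by simp
    show "a' D \<noteq> 0 \<and> D = {x. a' D \<bullet> x \<le> b' D}" if D: "D \<in> H ` I" for D
    proof -
      obtain i where i: "i \<in> I" "D = H i" using D by auto
      have "a i \<noteq> 0"
        using h[OF i(1), of w] h[OF i(1), of "q i"] q(2)[OF i(1)] w(2)[OF i(1)] by auto
      then show ?thesis using i inv by (simp add: a'_def b'_def H_def)
    qed
    \<comment> \<open>A proper subfamily omits some \<open>H i\<close> and therefore admits the
      point \<open>z\<close> beyond the \<open>i\<close>-th face.\<close>
    show "P \<subset> affine hull P \<inter> \<Inter>F'" if F': "F' \<subset> H ` I" for F'
    proof -
      obtain i where i: "i \<in> I" "H i \<notin> F'" using F' by auto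
      obtain z where z: "h i z < 0" "\<forall>j\<in>I - {i}. h j z > 0" using outside[OF i(1)] by auto
      have "z \<in> \<Inter>F'"
      proof
        fix D assume "D \<in> F'"
        then obtain j where "j \<in> I" "D = H j" "j \<noteq> i" using F' i(2) by blast
        then show "z \<in> D" using z(2) H[of j] less_imp_le by blast
      qed
      moreover have "z \<notin> P" using z(1) i(1) by (force simp: P not_le)
      ultimately show ?thesis using PH F' aff by blast
    qed
  qed
  define T where "T i = P \<inter> {x. h i x = 0}" for i
  have "P \<inter> {x. a' (H i) \<bullet> x = b' (H i)} = T i" if "i \<in> I" for i
    using h[OF that] unfolding T_def a'_def b'_def inv[OF that] by (smt (verit) Collect_cong)
  then have "{C. C facet_of P} = T ` I"
    unfolding facet by (auto simp: image_iff)
  moreover have "inj_on T I"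
  proof (rule inj_onI, rule ccontr)
    fix i j assume *: "i \<in> I" "j \<in> I" "T i = T j" "i \<noteq> j"
    have "q i \<in> T i" using q *(1) by (simp add: T_def)
    then have "h j (q i) = 0" unfolding \<open>T i = T j\<close> by (simp add: T_def)
    then show False using q(3)[of i j] *(1,2,4) by simp
  qed
  ultimately show ?thesis by (simp add: card_image)
qed

section \<open>Planar regions between a chain of edges and its closing chord\<close>

lemma interval_step:
  fixes V :: "nat \<Rightarrow> real"
  assumes "V 0 \<le> x" "x \<le> V n" "n > 0"
  shows "\<exists>a<n. V a \<le> x \<and> x \<le> V (Suc a)"
  using assms(2,3)
proof (induction n)
  case (Suc n)
  show ?case
  proof (cases "n = 0 \<or> V n \<le> x")
    case True
    then show ?thesis using assms(1) Suc.prems by auto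
  next
    case False
    then show ?thesis using Suc.IH less_SucI by fastforce
  qed
qed simp

lemma convex_segment_point:
  fixes C :: "(real \<times> real) set"
  assumes "convex C" "(x0, y0) \<in> C" "(x1, y1) \<in> C" "x0 < x1" "x0 \<le> x" "x \<le> x1"
  shows "(x, y0 + (y1 - y0) / (x1 - x0) * (x - x0)) \<in> C"
proof -
  define t where "t = (x - x0) / (x1 - x0)"
  have t: "0 \<le> t" "t \<le> 1" "t * (x1 - x0) = x - x0"
    using assms by (auto simp: t_def)
  have "(1 - t) *\<^sub>R (x0, y0) + t *\<^sub>R (x1, y1) \<in> C"
    using assms t by (intro convexD) auto
  moreover have "(1 - t) * x0 + t * x1 = x" using t(3) by (simp add: algebra_simps)
  moreover have "(1 - t) * y0 + t * y1 = y0 + (y1 - y0) / (x1 - x0) * (x - x0)"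
  proof -
    have "(y1 - y0) / (x1 - x0) * (x - x0) = t * (y1 - y0)" by (simp add: t_def)
    then show ?thesis by (simp add: algebra_simps)
  qed
  ultimately show ?thesis by simp
qed

lemma convex_vertical:
  fixes C :: "(real \<times> real) set"
  assumes "convex C" "(x, l) \<in> C" "(x, u) \<in> C" "l \<le> y" "y \<le> u"
  shows "(x, y) \<in> C"
proof (cases "l = u")
  case False
  define t where "t = (y - l) / (u - l)"
  have t: "0 \<le> t" "t \<le> 1" "t * (u - l) = y - l"
    using assms False by (auto simp: t_def)
  have "(1 - t) *\<^sub>R (x, l) + t *\<^sub>R (x, u) \<in> C"
    using assms t by (intro convexD) auto
  moreover have "(1 - t) * l + t * u = y" using t(3) by (simp add: algebra_simps)
  moreover have "(1 - t) * x + t * x = x" by (simp add: algebra_simps)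
  ultimately show ?thesis by simp
qed (use assms in auto)

text \<open>The chord has slope strictly between those of the first and the last edge, so these
  three inequalities confine \<open>x\<close> to the range of the chain. There \<open>(x, y)\<close>
  lies on a vertical segment from an edge of the chain up to the chord, and both ends of the segment
  belong to \<open>C\<close>.\<close>

lemma between_chain_and_chord:
  fixes C :: "(real \<times> real) set" and V q S :: "nat \<Rightarrow> real"
  assumes "convex C" and vert: "\<And>b. b \<le> n \<Longrightarrow> (V b, q b) \<in> C" and "n > 0"
    and mono: "\<And>a. a < n \<Longrightarrow> V a < V (Suc a)" "V 0 < V n"
    and slope: "\<And>a. a < n \<Longrightarrow> q (Suc a) - q a = S a * (V (Suc a) - V a)"
    and chord: "q n - q 0 = T * (V n - V 0)"
    and T: "S 0 < T" "T < S (n - 1)"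
    and lower: "\<And>a. a < n \<Longrightarrow> y \<ge> q a + S a * (x - V a)"
    and upper: "y \<le> q 0 + T * (x - V 0)"
  shows "(x, y) \<in> C"
proof -
  \<comment> \<open>The first edge and the chord both start at the vertex \<open>(V 0, q 0)\<close>;
    the last edge and the chord are compared in the same way at their common end.\<close>
  have "(T - S 0) * (x - V 0) \<ge> 0"
    using lower[of 0] upper \<open>n > 0\<close> by (simp add: algebra_simps)
  then have x0: "V 0 \<le> x" using T(1) by (simp add: zero_le_mult_iff)
  have "q n = q (n - 1) + S (n - 1) * (V n - V (n - 1))"
    using slope[of "n - 1"] \<open>n > 0\<close> by simp
  then have "y \<ge> q n + S (n - 1) * (x - V n)"
    using lower[of "n - 1"] \<open>n > 0\<close> by (simp add: algebra_simps)
  moreover have "y \<le> q n + T * (x - V n)"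
    using upper chord by (simp add: algebra_simps)
  ultimately have "(S (n - 1) - T) * (V n - x) \<ge> 0" by (simp add: algebra_simps)
  then have xn: "x \<le> V n" using T(2) by (simp add: zero_le_mult_iff)
  obtain a where a: "a < n" "V a \<le> x" "x \<le> V (Suc a)"
    using interval_step[OF x0 xn \<open>n > 0\<close>] by blast
  have "(x, q a + (q (Suc a) - q a) / (V (Suc a) - V a) * (x - V a)) \<in> C"
    using a mono(1)[OF a(1)] by (intro convex_segment_point assms) auto
  then have L: "(x, q a + S a * (x - V a)) \<in> C"
    using slope[OF a(1)] mono(1)[OF a(1)] by simp
  have "(x, q 0 + (q n - q 0) / (V n - V 0) * (x - V 0)) \<in> C"
    using x0 xn mono(2) by (intro convex_segment_point assms) auto
  then have U: "(x, q 0 + T * (x - V 0)) \<in> C"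
    using chord mono(2) by simp
  show ?thesis
    using convex_vertical[OF \<open>convex C\<close> L U lower[OF a(1)] upper] .
qed

section \<open>Coordinate projections are orthogonal projections\<close>

lemma orthogonal_projection_pair:
  fixes i j :: "'d::finite"
  assumes "i \<noteq> j"
  shows "orthogonal_projection (\<lambda>x::real^'d. vector [x $ i, x $ j] :: real^2)"
  unfolding orthogonal_projection_def
proof (intro exI conjI ballI allI)
  define U where "U = {x::real^'d. \<forall>l. l \<noteq> i \<longrightarrow> l \<noteq> j \<longrightarrow> x $ l = 0}"
  define \<phi> where "\<phi> = (\<lambda>x::real^'d. vector [x $ i, x $ j] :: real^2)"
  show U: "subspace U" by (auto simp: subspace_def U_def)
  show "linear \<phi>"
    by (rule linearI) (auto simp: \<phi>_def vec_eq_iff forall_2)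
  show "norm (\<phi> u) = norm u" if "u \<in> U" for u
  proof -
    have "(\<Sum>l\<in>UNIV. (norm (u $ l))\<^sup>2) = (\<Sum>l\<in>{i, j}. (norm (u $ l))\<^sup>2)"
      using that by (intro sum.mono_neutral_right) (auto simp: U_def)
    then show ?thesis
      using assms by (simp add: norm_vec_def L2_set_def \<phi>_def sum_2)
  qed
  show "\<phi> ` U = UNIV"
  proof (intro equalityI subsetI)
    fix v :: "real^2"
    have U': "(\<chi> l. if l = i then v $ 1 else if l = j then v $ 2 else 0) \<in> U"
      by (simp add: U_def)
    have "\<phi> (\<chi> l. if l = i then v $ 1 else if l = j then v $ 2 else 0) = v"
      using assms by (auto simp: \<phi>_def vec_eq_iff forall_2)
    then show "v \<in> \<phi> ` U" using U' by (rule image_eqI[OF sym])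
  qed simp
  show "(vector [x $ i, x $ j] :: real^2) = \<phi> (closest_point U x)" for x
  proof -
    let ?y = "\<chi> l. if l = i \<or> l = j then x $ l else 0"
    have y: "?y = closest_point U x"
    proof (rule closest_point_unique)
      show "convex U" using U by (rule subspace_imp_convex)
      show "closed U" using U by (rule closed_subspace)
      show "?y \<in> U" by (simp add: U_def)
      \<comment> \<open>Coordinatewise: \<open>x - ?y\<close> vanishes at \<open>i\<close> and
        \<open>j\<close>, and elsewhere it equals \<open>x - z\<close> because \<open>z\<close> and
        \<open>?y\<close> vanish there.\<close>
      show "\<forall>z\<in>U. dist x ?y \<le> dist x z"
        unfolding dist_norm by (intro ballI norm_le_componentwise_cart) (auto simp: U_def)
    qed
    then show ?thesis by (simp add: \<phi>_def flip: y)
  qed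
qed

section \<open>Unfolding a level into the polygon above it\<close>

text \<open>
  \<open>unfold_x K b\<close> is the inverse on \<open>[b K, (b + 1) K - 1]\<close> of the triangular wave with range \<open>[0, K - 1]\<close>;
  \<open>unfold_y\<close> expresses its square as an affine function of \<open>x\<close> and \<open>y = x\<^sup>2\<close>.
\<close>

definition unfold_x :: "real \<Rightarrow> nat \<Rightarrow> real \<Rightarrow> real" where
  "unfold_x K b x = (if even b then real b * K + x else (real b + 1) * K - 1 - x)"

definition unfold_y :: "real \<Rightarrow> nat \<Rightarrow> real \<Rightarrow> real \<Rightarrow> real" where
  "unfold_y K b x y =
     (if even b then (real b * K)\<^sup>2 + 2 * (real b * K) * x + y
      else ((real b + 1) * K - 1)\<^sup>2 - 2 * ((real b + 1) * K - 1) * x + y)"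

text \<open>Slack of \<open>(x', y')\<close> in the inequality of edge \<open>a\<close> of the
  polygon over \<open>(x, y)\<close>. Edges before the last bound \<open>y'\<close> from below; the
  closing edge \<open>a = N - 1\<close> bounds it from above by the line through vertex
  \<open>0\<close>, which is \<open>(x, y)\<close> itself. The slopes are the sums of the abscissae
  of the two end vertices.\<close>

definition edge_gap :: "nat \<Rightarrow> real \<Rightarrow> nat \<Rightarrow> real \<Rightarrow> real \<Rightarrow> real \<Rightarrow> real \<Rightarrow> real" where
  "edge_gap N K a x y x' y' =
     (if Suc a = N then y + (real N * K - 1) * (x' - x) - y'
      else y' - (unfold_y K a x y + (2 * (real a + 1) * K - 1) * (x' - unfold_x K a x)))"

lemma unfold_y_square: "unfold_y K b x (x\<^sup>2) = (unfold_x K b x)\<^sup>2"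
  by (simp add: unfold_x_def unfold_y_def power2_eq_square algebra_simps)

lemma unfold_x_step:
  assumes "0 \<le> x" "x \<le> K - 1"
  shows "unfold_x K a x + 1 \<le> unfold_x K (Suc a) x"
  using assms by (simp add: unfold_x_def algebra_simps)

lemma unfold_x_less:
  assumes "0 \<le> x" "x \<le> K - 1" "a < b"
  shows "unfold_x K a x < unfold_x K b x"
proof -
  have "unfold_x K i x < unfold_x K (Suc i) x" for i
    using unfold_x_step[OF assms(1,2), of i] by linarith
  then show ?thesis using assms(3) by (rule lift_Suc_mono_less)
qed

text \<open>
  The slope does not depend on \<open>x\<close>: the reflection of every other block keeps the sum of the
  abscissae of consecutive vertices constant.
\<close>

lemma unfold_slope:
  "unfold_y K (Suc a) x y - unfold_y K a x y =
     (2 * (real a + 1) * K - 1) * (unfold_x K (Suc a) x - unfold_x K a x)"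
  by (cases "even a") (simp_all add: unfold_x_def unfold_y_def power2_eq_square algebra_simps)

text \<open>The vertices \<open>0\<close> to \<open>N - 1\<close> form the chain, and the closing
  edge is the chord. Since \<open>y\<close> need not be \<open>x\<^sup>2\<close>, this covers fibres
  over all points of the lower polytope and not only over its vertices.\<close>

lemma fibre_polygon:
  fixes C :: "(real \<times> real) set"
  assumes N: "even N" "N \<ge> 4" and x: "0 \<le> x" "x \<le> K - 1"
    and "convex C" and C: "\<And>b. b < N \<Longrightarrow> (unfold_x K b x, unfold_y K b x y) \<in> C"
    and gap: "\<And>a. a < N \<Longrightarrow> edge_gap N K a x y x' y' \<ge> 0"
  shows "(x', y') \<in> C"
proof (rule between_chain_and_chord)
  show "convex C" by fact
  show "N - 1 > 0" using N by simp
  show "(unfold_x K b x, unfold_y K b x y) \<in> C" if "b \<le> N - 1" for b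
    using C that N by simp
  show "unfold_x K a x < unfold_x K (Suc a) x" for a
    using x by (rule unfold_x_less) simp
  show "unfold_x K 0 x < unfold_x K (N - 1) x"
    using x by (rule unfold_x_less) (use N in simp)
  show "unfold_y K (Suc a) x y - unfold_y K a x y =
     (2 * (real a + 1) * K - 1) * (unfold_x K (Suc a) x - unfold_x K a x)" for a
    by (rule unfold_slope)
  \<comment> \<open>As \<open>N - 1\<close> is odd, the last abscissa is
    \<open>N * K - 1 - x\<close>, so its sum with the first abscissa \<open>x\<close> is free of
    \<open>x\<close>.\<close>
  show "unfold_y K (N - 1) x y - unfold_y K 0 x y =
      (real N * K - 1) * (unfold_x K (N - 1) x - unfold_x K 0 x)"
    using N by (simp add: unfold_x_def unfold_y_def of_nat_diff power2_eq_square algebra_simps)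
  show "2 * (real 0 + 1) * K - 1 < real N * K - 1"
    using N x by simp
  have "real N * K < (2 * (real N - 1)) * K"
    using N x by (intro mult_strict_right_mono) auto
  then show "real N * K - 1 < 2 * (real (N - 1 - 1) + 1) * K - 1"
    using N by (simp add: of_nat_diff)
  show "y' \<ge> unfold_y K a x y + (2 * (real a + 1) * K - 1) * (x' - unfold_x K a x)"
    if "a < N - 1" for a
  proof -
    have "a < N" "Suc a \<noteq> N" using that by auto
    then show ?thesis using gap[of a] by (simp add: edge_gap_def)
  qed
  show "y' \<le> unfold_y K 0 x y + (real N * K - 1) * (x' - unfold_x K 0 x)"
    using gap[of "N - 1"] N by (simp add: edge_gap_def unfold_y_def unfold_x_def)
qed

text \<open>The secant of the parabola through the abscissae \<open>u\<close> and \<open>v\<close>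
  differs from \<open>x'\<^sup>2\<close> by \<open>(x' - u) * (x' - v)\<close>; the sign is reversed
  for the closing edge.\<close>

lemma edge_gap_parabola:
  assumes "even N" "a < N"
  shows "edge_gap N K a x (x\<^sup>2) x' (x'\<^sup>2) =
    (if Suc a = N then (x' - unfold_x K 0 x) * (unfold_x K a x - x')
     else (x' - unfold_x K a x) * (x' - unfold_x K (Suc a) x))"
proof (cases "Suc a = N")
  case True
  then have "odd a" using assms by auto
  then show ?thesis unfolding True[symmetric]
    by (simp add: edge_gap_def unfold_x_def power2_eq_square algebra_simps)
next
  case False
  then show ?thesis
    by (simp add: edge_gap_def unfold_x_def unfold_y_def power2_eq_square algebra_simps)
qed

text \<open>No vertex abscissa lies strictly between two consecutive ones, and all lie between the
  first and the last, which fixes the sign of the product. Its zeros give the incidences of an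
  \<open>N\<close>-gon with edges labelled cyclically.\<close>

lemma edge_gap_vertex:
  assumes "even N" "0 \<le> x" "x \<le> K - 1" "a < N" "b < N"
  defines "x' \<equiv> unfold_x K b x"
  shows "edge_gap N K a x (x\<^sup>2) x' (x'\<^sup>2) \<ge> 0"
    and "edge_gap N K a x (x\<^sup>2) x' (x'\<^sup>2) = 0 \<longleftrightarrow> b = a \<or> b = Suc a mod N"
proof -
  have less: "unfold_x K i x < unfold_x K j x \<longleftrightarrow> i < j" for i j
    using unfold_x_less[OF assms(2,3)] by (metis less_asym linorder_neqE_nat)
  have eq: "unfold_x K i x = unfold_x K j x \<longleftrightarrow> i = j" for i j
    using less by (metis less_irrefl linorder_neqE_nat)
  have le: "unfold_x K i x \<le> unfold_x K j x \<longleftrightarrow> i \<le> j" for i j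
    using less by (metis not_le)
  have "Suc a mod N = (if Suc a = N then 0 else Suc a)"
    using assms by auto
  then show "edge_gap N K a x (x\<^sup>2) x' (x'\<^sup>2) = 0 \<longleftrightarrow> b = a \<or> b = Suc a mod N"
    unfolding edge_gap_parabola[OF assms(1,4)] x'_def using eq by auto
  show "edge_gap N K a x (x\<^sup>2) x' (x'\<^sup>2) \<ge> 0"
  proof (cases "Suc a = N")
    case True
    then have "unfold_x K 0 x \<le> x'" "x' \<le> unfold_x K a x"
      using assms by (auto simp: le)
    then show ?thesis using True edge_gap_parabola[OF assms(1,4)] by simp
  next
    case False
    have "x' \<le> unfold_x K a x \<and> x' \<le> unfold_x K (Suc a) x \<or>
          unfold_x K a x \<le> x' \<and> unfold_x K (Suc a) x \<le> x'"
      by (auto simp: x'_def le)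
    then show ?thesis
      using False edge_gap_parabola[OF assms(1,4)] by (auto intro: mult_nonpos_nonpos)
  qed
qed

section \<open>The reflected base-\<open>N\<close> code\<close>

text \<open>Integer counterpart of \<open>unfold_x\<close>: prepends the most significant digit
  \<open>b\<close> to \<open>s < K\<close>, reversing the block when \<open>b\<close> is
  odd.\<close>

definition digit_step :: "nat \<Rightarrow> nat \<Rightarrow> nat \<Rightarrow> nat" where
  "digit_step K b s = b * K + (if even b then s else K - 1 - s)"

lemma digit_step_less:
  assumes "b < N" "s < K"
  shows "digit_step K b s < N * K"
proof -
  have "digit_step K b s < Suc b * K" using assms(2) by (auto simp: digit_step_def)
  also have "\<dots> \<le> N * K" using assms(1) by (intro mult_right_mono) auto
  finally show ?thesis .
qed

lemma real_digit_step:
  assumes "s < K"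
  shows "real (digit_step K b s) = unfold_x (real K) b (real s)"
  using assms by (auto simp: digit_step_def unfold_x_def of_nat_diff algebra_simps)

lemma digit_step_inj:
  assumes "digit_step K b s = digit_step K c t" "s < K" "t < K"
  shows "s = t"
proof -
  \<comment> \<open>Reflection stays within the block, so the quotient by \<open>K\<close> recovers
    the digit.\<close>
  have div: "digit_step K b s div K = b" if "s < K" for b s
    unfolding digit_step_def using that by (intro div_nat_eqI) auto
  have "b = c" using div[OF assms(2)] div[OF assms(3)] assms(1) by metis
  then show ?thesis using assms by (auto simp: digit_step_def split: if_splits)
qed

lemma digit_step_surj:
  assumes "t < N * K"
  shows "\<exists>b<N. \<exists>s<K. t = digit_step K b s"
proof (intro exI conjI)
  have "K > 0" using assms by (cases K) auto
  let ?b = "t div K" and ?r = "t mod K"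
  have r: "?r < K" using \<open>K > 0\<close> by simp
  show "?b < N" using assms by (simp add: less_mult_imp_div_less)
  show "(if even ?b then ?r else K - 1 - ?r) < K" using r by auto
  show "t = digit_step K ?b (if even ?b then ?r else K - 1 - ?r)"
    using r by (simp add: digit_step_def)
qed

text \<open>Only the values up to \<open>m\<close> are constrained, so a chain is prolonged by a
  function update at \<open>Suc m\<close>.\<close>

definition digit_chain :: "nat \<Rightarrow> nat \<Rightarrow> (nat \<Rightarrow> nat) \<Rightarrow> bool" where
  "digit_chain N m \<rho> \<longleftrightarrow>
     \<rho> 0 = 0 \<and> (\<forall>i<m. \<exists>b<N. \<rho> (Suc i) = digit_step (N ^ i) b (\<rho> i))"

lemma digit_chain_less:
  assumes "digit_chain N m \<rho>" "i \<le> m"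
  shows "\<rho> i < N ^ i"
  using assms(2)
proof (induction i)
  case 0
  then show ?case using assms by (simp add: digit_chain_def)
next
  case (Suc i)
  then obtain b where "b < N" "\<rho> (Suc i) = digit_step (N ^ i) b (\<rho> i)"
    using assms by (auto simp: digit_chain_def Suc_le_eq)
  then show ?case using Suc digit_step_less[of b N "\<rho> i" "N ^ i"] by simp
qed

lemma digit_chain_upd:
  assumes "digit_chain N m \<rho>" "b < N"
  shows "digit_chain N (Suc m) (\<rho>(Suc m := digit_step (N ^ m) b (\<rho> m)))"
  using assms unfolding digit_chain_def by (auto simp: less_Suc_eq)

lemma digit_chain_surj: "t < N ^ m \<Longrightarrow> \<exists>\<rho>. digit_chain N m \<rho> \<and> \<rho> m = t"
proof (induction m arbitrary: t)
  case 0
  then show ?case by (intro exI[of _ "\<lambda>_. 0"]) (simp add: digit_chain_def)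
next
  case (Suc m)
  then obtain b s where bs: "b < N" "s < N ^ m" "t = digit_step (N ^ m) b s"
    using digit_step_surj[of t N "N ^ m"] by auto
  obtain \<rho> where "digit_chain N m \<rho>" "\<rho> m = s"
    using Suc.IH bs(2) by blast
  then have "digit_chain N (Suc m) (\<rho>(Suc m := t))"
    using digit_chain_upd bs by blast
  then show ?case by (metis fun_upd_same)
qed

lemma digit_chain_inj:
  assumes "digit_chain N m \<rho>" "digit_chain N m \<sigma>" "\<rho> m = \<sigma> m" "i \<le> m"
  shows "\<rho> i = \<sigma> i"
  using assms(4)
proof (induction i rule: inc_induct)
  case base
  show ?case by fact
next
  case (step i)
  obtain b c where "\<rho> (Suc i) = digit_step (N ^ i) b (\<rho> i)" "\<sigma> (Suc i) = digit_step (N ^ i) c (\<sigma> i)"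
    using assms(1,2) step.hyps unfolding digit_chain_def by blast
  moreover have "\<rho> i < N ^ i" "\<sigma> i < N ^ i"
    using assms(1,2) step.hyps by (auto intro: digit_chain_less)
  ultimately show ?case using step.IH digit_step_inj by metis
qed

section \<open>The deformed product of polygons in level coordinates\<close>

text \<open>
  The pairs \<open>(X i z, Y i z)\<close> for \<open>1 \<le> i \<le> k\<close> are linear coordinates of \<open>z\<close> with inverse \<open>pt\<close>;
  level \<open>0\<close> is a dummy that starts the recursion.
\<close>

locale level_coordinates =
  fixes N k :: nat
    and X Y :: "nat \<Rightarrow> 'a::euclidean_space \<Rightarrow> real"
    and pt :: "(nat \<Rightarrow> real) \<Rightarrow> (nat \<Rightarrow> real) \<Rightarrow> 'a"
  assumes N: "even N" "N \<ge> 4"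
    and linear_X: "linear (X i)" and linear_Y: "linear (Y i)"
    and X_0 [simp]: "X 0 z = 0" and Y_0 [simp]: "Y 0 z = 0"
    and X_pt: "0 < i \<Longrightarrow> i \<le> k \<Longrightarrow> X i (pt f g) = f i"
    and Y_pt: "0 < i \<Longrightarrow> i \<le> k \<Longrightarrow> Y i (pt f g) = g i"
    and coords_eqI: "(\<And>i. 0 < i \<Longrightarrow> i \<le> k \<Longrightarrow> X i z = X i w \<and> Y i z = Y i w) \<Longrightarrow> z = w"
begin

lemma X_combine: "X i (u *\<^sub>R z + v *\<^sub>R w) = u * X i z + v * X i w"
  by (simp add: linear_add[OF linear_X] linear_scale[OF linear_X])

lemma Y_combine: "Y i (u *\<^sub>R z + v *\<^sub>R w) = u * Y i z + v * Y i w"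
  by (simp add: linear_add[OF linear_Y] linear_scale[OF linear_Y])

text \<open>Levels above \<open>m\<close> are left free, so for \<open>m < k\<close> this is a
  cylinder over the vertices of the first \<open>m\<close> levels. The induction over levels can
  thus stay in one space.\<close>

definition verts :: "nat \<Rightarrow> 'a set" where
  "verts m = {z. \<exists>\<rho>. digit_chain N m \<rho> \<and> (\<forall>i\<le>m. X i z = real (\<rho> i) \<and> Y i z = (real (\<rho> i))\<^sup>2)}"

fun gap :: "nat \<times> nat \<Rightarrow> 'a \<Rightarrow> real" where
  "gap (i, a) z = edge_gap N (real (N ^ i)) a (X i z) (Y i z) (X (Suc i) z) (Y (Suc i) z)"

lemma linear_gap: "linear (\<lambda>z. gap j z - gap j 0)"
proof (cases j)
  case (Pair i a)
  show ?thesis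
    unfolding Pair
    by (rule linearI)
      (auto simp: edge_gap_def unfold_x_def unfold_y_def algebra_simps
        linear_add[OF linear_X] linear_scale[OF linear_X] linear_0[OF linear_X]
        linear_add[OF linear_Y] linear_scale[OF linear_Y] linear_0[OF linear_Y])
qed

definition extend :: "nat \<Rightarrow> 'a \<Rightarrow> real \<Rightarrow> real \<Rightarrow> 'a" where
  "extend m z x y = pt ((\<lambda>i. X i z)(m := x)) ((\<lambda>i. Y i z)(m := y))"

lemma X_extend: "0 < m \<Longrightarrow> i \<le> k \<Longrightarrow> X i (extend m z x y) = (if i = m then x else X i z)"
  by (cases "i = 0") (auto simp: extend_def X_pt)

lemma Y_extend: "0 < m \<Longrightarrow> i \<le> k \<Longrightarrow> Y i (extend m z x y) = (if i = m then y else Y i z)"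
  by (cases "i = 0") (auto simp: extend_def Y_pt)

lemma extend_combine:
  assumes "0 < m"
  shows "extend m (u *\<^sub>R z + v *\<^sub>R w) (u * x + v * x') (u * y + v * y') =
     u *\<^sub>R extend m z x y + v *\<^sub>R extend m w x' y'"
  by (rule coords_eqI) (use assms in \<open>auto simp: X_extend Y_extend X_combine Y_combine\<close>)

text \<open>Supplies the range of abscissae in which the vertices of a fibre are known to be
  ordered; it passes from the code values to the hull by convexity.\<close>

lemma X_hull_bounds:
  assumes "z \<in> convex hull verts m"
  shows "0 \<le> X m z" "X m z \<le> real (N ^ m) - 1"
proof -
  have "convex hull verts m \<subseteq> X m -` {0..real (N ^ m) - 1}"
  proof (rule hull_minimal)
    show "convex (X m -` {0..real (N ^ m) - 1})"
      by (intro convex_linear_vimage linear_X) auto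
    show "verts m \<subseteq> X m -` {0..real (N ^ m) - 1}"
    proof
      fix z assume "z \<in> verts m"
      then obtain \<rho> where "digit_chain N m \<rho>" "X m z = real (\<rho> m)"
        by (auto simp: verts_def)
      moreover from this have "real (\<rho> m) + 1 \<le> real (N ^ m)"
        using digit_chain_less[of N m \<rho> m] by linarith
      ultimately show "z \<in> X m -` {0..real (N ^ m) - 1}" by simp
    qed
  qed
  then show "0 \<le> X m z" "X m z \<le> real (N ^ m) - 1" using assms by auto
qed

lemma extend_verts:
  assumes "Suc m \<le> k" "b < N" "z \<in> verts m"
  shows "extend (Suc m) z (unfold_x (N ^ m) b (X m z)) (unfold_y (N ^ m) b (X m z) (Y m z))
      \<in> verts (Suc m)"
proof -
  obtain \<rho> where \<rho>: "digit_chain N m \<rho>" "\<And>i. i \<le> m \<Longrightarrow> X i z = real (\<rho> i) \<and> Y i z = (real (\<rho> i))\<^sup>2"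
    using assms(3) by (auto simp: verts_def)
  let ?s = "digit_step (N ^ m) b (\<rho> m)"
  have s: "unfold_x (N ^ m) b (X m z) = real ?s"
      "unfold_y (N ^ m) b (X m z) (Y m z) = (real ?s)\<^sup>2"
    using \<rho>(2)[of m] digit_chain_less[OF \<rho>(1), of m]
    by (auto simp: real_digit_step unfold_y_square)
  show ?thesis
    unfolding s verts_def
    using digit_chain_upd[OF \<rho>(1) assms(2)] assms(1) \<rho>(2)
    by (intro CollectI exI[of _ "\<rho>(Suc m := ?s)"]) (auto simp: X_extend Y_extend)
qed

text \<open>For a fixed digit \<open>b\<close> the new pair depends affinely on the old one. Hence
  the points whose extension lies in the next hull form a convex set, and that set contains
  \<open>verts m\<close>.\<close>

lemma extend_hull_verts:
  assumes "Suc m \<le> k" "b < N" "z \<in> convex hull verts m"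
  shows "extend (Suc m) z (unfold_x (N ^ m) b (X m z)) (unfold_y (N ^ m) b (X m z) (Y m z))
      \<in> convex hull verts (Suc m)"
proof -
  let ?D = "\<lambda>z. extend (Suc m) z (unfold_x (N ^ m) b (X m z)) (unfold_y (N ^ m) b (X m z) (Y m z))"
  have "convex {z. ?D z \<in> convex hull verts (Suc m)}"
  proof (rule convexI)
    fix z w and u v :: real
    assume *: "z \<in> {z. ?D z \<in> convex hull verts (Suc m)}" "w \<in> {z. ?D z \<in> convex hull verts (Suc m)}"
      "0 \<le> u" "0 \<le> v" "u + v = 1"
    have v: "v = 1 - u" using *(5) by simp
    have "unfold_x (N ^ m) b (X m (u *\<^sub>R z + v *\<^sub>R w)) =
        u * unfold_x (N ^ m) b (X m z) + v * unfold_x (N ^ m) b (X m w)"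
      unfolding X_combine unfolding v by (simp add: unfold_x_def algebra_simps)
    moreover have "unfold_y (N ^ m) b (X m (u *\<^sub>R z + v *\<^sub>R w)) (Y m (u *\<^sub>R z + v *\<^sub>R w)) =
        u * unfold_y (N ^ m) b (X m z) (Y m z) + v * unfold_y (N ^ m) b (X m w) (Y m w)"
      unfolding X_combine Y_combine unfolding v by (simp add: unfold_y_def algebra_simps)
    ultimately have "?D (u *\<^sub>R z + v *\<^sub>R w) = u *\<^sub>R ?D z + v *\<^sub>R ?D w"
      by (simp add: extend_combine)
    then show "u *\<^sub>R z + v *\<^sub>R w \<in> {z. ?D z \<in> convex hull verts (Suc m)}"
      using * by (auto intro: convexD[OF convex_convex_hull])
  qed
  moreover have "verts m \<subseteq> {z. ?D z \<in> convex hull verts (Suc m)}"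
    using extend_verts[OF assms(1,2)] by (auto intro: hull_inc)
  ultimately have "convex hull verts m \<subseteq> {z. ?D z \<in> convex hull verts (Suc m)}"
    by (intro hull_minimal)
  then show ?thesis using assms(3) by blast
qed

section \<open>The hull of the vertices as a system of edge inequalities\<close>

text \<open>Builds a hull point with the coordinates of \<open>z\<close> level by level: the
  inequalities of the next level place the next pair of \<open>z\<close> in the polygon over the
  point \<open>w\<close> found so far.\<close>

lemma gap_imp_hull_prefix:
  assumes "m \<le> k" "\<And>i a. i < m \<Longrightarrow> a < N \<Longrightarrow> gap (i, a) z \<ge> 0"
  shows "\<exists>w\<in>convex hull verts m. \<forall>i\<le>m. X i w = X i z \<and> Y i w = Y i z"
  using assms
proof (induction m)
  case 0
  have "0 \<in> verts 0"
    unfolding verts_def by (intro CollectI exI[of _ "\<lambda>_. 0"]) (simp add: digit_chain_def)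
  then show ?case by (intro bexI[of _ 0] hull_inc) auto
next
  case (Suc m)
  then obtain w where w: "w \<in> convex hull verts m" "\<And>i. i \<le> m \<Longrightarrow> X i w = X i z \<and> Y i w = Y i z"
    by auto
  \<comment> \<open>The fibre over \<open>w\<close> of the next hull; it is convex and contains the
    \<open>N\<close> polygon vertices over \<open>w\<close>.\<close>
  let ?C = "{(x, y). extend (Suc m) w x y \<in> convex hull verts (Suc m)}"
  have "(X (Suc m) z, Y (Suc m) z) \<in> ?C"
  proof (rule fibre_polygon[OF N])
    show "0 \<le> X m w" "X m w \<le> real (N ^ m) - 1" using X_hull_bounds[OF w(1)] .
    show "convex ?C"
    proof (rule convexI)
      fix p q :: "real \<times> real" and u v :: real
      assume *: "p \<in> ?C" "q \<in> ?C" "0 \<le> u" "0 \<le> v" "u + v = 1"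
      have "u *\<^sub>R w + v *\<^sub>R w = w" using *(5) by (metis scaleR_add_left scaleR_one)
      then have "extend (Suc m) w (u * fst p + v * fst q) (u * snd p + v * snd q) =
          u *\<^sub>R extend (Suc m) w (fst p) (snd p) + v *\<^sub>R extend (Suc m) w (fst q) (snd q)"
        using extend_combine[of "Suc m" u w v w] by simp
      then show "u *\<^sub>R p + v *\<^sub>R q \<in> ?C"
        using * by (auto simp: case_prod_beta intro: convexD[OF convex_convex_hull])
    qed
    show "(unfold_x (N ^ m) b (X m w), unfold_y (N ^ m) b (X m w) (Y m w)) \<in> ?C" if "b < N" for b
      using extend_hull_verts[OF Suc.prems(1) that w(1)] by simp
    show "edge_gap N (real (N ^ m)) a (X m w) (Y m w) (X (Suc m) z) (Y (Suc m) z) \<ge> 0" if "a < N" for a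
      using Suc.prems(2)[of m a] that w(2)[of m] by simp
  qed
  then show ?case
    using Suc.prems(1) w(2)
    by (intro bexI[of _ "extend (Suc m) w (X (Suc m) z) (Y (Suc m) z)"])
      (auto simp: X_extend Y_extend le_Suc_eq)
qed

lemma gap_verts:
  assumes "z \<in> verts k" "i < k" "a < N"
  shows "gap (i, a) z \<ge> 0"
proof -
  obtain \<rho> where \<rho>: "digit_chain N k \<rho>" "\<And>i. i \<le> k \<Longrightarrow> X i z = real (\<rho> i) \<and> Y i z = (real (\<rho> i))\<^sup>2"
    using assms(1) by (auto simp: verts_def)
  obtain b where b: "b < N" "\<rho> (Suc i) = digit_step (N ^ i) b (\<rho> i)"
    using \<rho>(1) assms(2) by (auto simp: digit_chain_def)
  have less: "\<rho> i < N ^ i" using digit_chain_less[OF \<rho>(1)] assms(2) by simp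
  then have "real (\<rho> i) \<le> real (N ^ i) - 1" by linarith
  then show ?thesis
    using \<rho>(2)[of i] \<rho>(2)[of "Suc i"] assms(2,3) b less
      edge_gap_vertex(1)[OF N(1) _ _ assms(3) b(1), of "real (\<rho> i)" "real (N ^ i)"]
    by (simp add: real_digit_step)
qed

lemma convex_hull_verts:
  "convex hull verts k = {z. \<forall>j\<in>{..<k} \<times> {..<N}. gap j z \<ge> 0}" (is "_ = ?Q")
proof
  have "convex ?Q"
    by (rule convexI) (simp add: affine_functional_combine[OF linear_gap] del: gap.simps)
  moreover have "verts k \<subseteq> ?Q"
    using gap_verts by auto
  ultimately show "convex hull verts k \<subseteq> ?Q" by (rule hull_minimal[rotated])
  show "?Q \<subseteq> convex hull verts k"
  proof
    fix z assume z: "z \<in> ?Q"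
    obtain w where "w \<in> convex hull verts k" "\<forall>i\<le>k. X i w = X i z \<and> Y i w = Y i z"
      using gap_imp_hull_prefix[of k z] z by (auto simp del: gap.simps)
    moreover from this have "w = z" by (intro coords_eqI) auto
    ultimately show "z \<in> convex hull verts k" by simp
  qed
qed

section \<open>Incidences and the number of facets\<close>

text \<open>The digits can be prescribed independently, and whether a vertex satisfies inequality
  \<open>(i, a)\<close> with equality depends on digit \<open>i\<close> only. The incidences are
  therefore those of a product of \<open>k\<close> polygons.\<close>

lemma vertex_with_digits:
  assumes "\<And>i. \<delta> i < N"
  shows "\<exists>z\<in>verts k. \<forall>i<k. \<forall>a<N. gap (i, a) z = 0 \<longleftrightarrow> \<delta> i = a \<or> \<delta> i = Suc a mod N"
proof -
  define \<rho> where "\<rho> = rec_nat 0 (\<lambda>i. digit_step (N ^ i) (\<delta> i))"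
  have Suc: "\<rho> (Suc i) = digit_step (N ^ i) (\<delta> i) (\<rho> i)" for i by (simp add: \<rho>_def)
  have \<rho>: "digit_chain N k \<rho>"
    using assms Suc by (auto simp: digit_chain_def \<rho>_def)
  define z where "z = pt (\<lambda>i. real (\<rho> i)) (\<lambda>i. (real (\<rho> i))\<^sup>2)"
  have z: "X i z = real (\<rho> i) \<and> Y i z = (real (\<rho> i))\<^sup>2" if "i \<le> k" for i
    using that by (cases "i = 0") (auto simp: z_def X_pt Y_pt \<rho>_def)
  show ?thesis
  proof (intro bexI[of _ z] allI impI)
    show "z \<in> verts k" using \<rho> z by (auto simp: verts_def)
    fix i a assume ia: "i < k" "a < N"
    have less: "\<rho> i < N ^ i" using digit_chain_less[OF \<rho>] ia by simp
    then have "real (\<rho> i) \<le> real (N ^ i) - 1" by linarith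
    then show "gap (i, a) z = 0 \<longleftrightarrow> \<delta> i = a \<or> \<delta> i = Suc a mod N"
      using z[of i] z[of "Suc i"] ia less
        edge_gap_vertex(2)[OF N(1) _ _ ia(2) assms[of i], of "real (\<rho> i)" "real (N ^ i)"]
      by (simp add: real_digit_step Suc)
  qed
qed

lemma card_facets: "card {F. F facet_of convex hull verts k} = k * N"
proof -
  have sep: "\<exists>z\<in>verts k. gap (i, a) z = 0 \<and> gap (j, c) z > 0"
    if *: "i < k" "a < N" "j < k" "c < N" "(i, a) \<noteq> (j, c)" for i a j c
  proof -
    have mod: "Suc n mod N = (if Suc n = N then 0 else Suc n)" if "n < N" for n
      using that by auto
    \<comment> \<open>It suffices to pick digits on edge \<open>a\<close> at level \<open>i\<close>
      and off edge \<open>c\<close> at level \<open>j\<close>. At one level, distinct edges of the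
      \<open>N\<close>-gon share at most one vertex, so some end of \<open>a\<close> is off
      \<open>c\<close>; at different levels the two choices are independent.\<close>
    have "\<exists>\<delta>. (\<forall>l. \<delta> l < N) \<and> (\<delta> i = a \<or> \<delta> i = Suc a mod N) \<and> \<delta> j \<noteq> c \<and> \<delta> j \<noteq> Suc c mod N"
    proof (cases "i = j")
      case True
      then have "a \<noteq> c" using * by simp
      obtain b where "b < N" "b = a \<or> b = Suc a mod N" "b \<noteq> c" "b \<noteq> Suc c mod N"
      proof (cases "a = Suc c mod N")
        case True
        have "Suc a mod N < N" "Suc a mod N \<noteq> c" "Suc a mod N \<noteq> a"
          using *(2,4) N(2) True mod[of a] mod[of c] by (auto split: if_splits)
        then show ?thesis using that[of "Suc a mod N"] True by blast
      next
        case False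
        then show ?thesis using that[of a] *(2) \<open>a \<noteq> c\<close> by blast
      qed
      then show ?thesis using True by (intro exI[of _ "\<lambda>_. b"]) auto
    next
      case False
      obtain b where "b < N" "b \<noteq> c" "b \<noteq> Suc c mod N"
      proof -
        have "{..<N} - {c, Suc c mod N} \<noteq> {}"
        proof
          assume "{..<N} - {c, Suc c mod N} = {}"
          then have "{..<N} \<subseteq> {c, Suc c mod N}" by blast
          then have "card {..<N} \<le> card {c, Suc c mod N}" by (intro card_mono) auto
          also have "\<dots> \<le> 2" by (simp add: card_insert_if)
          finally show False using N(2) by simp
        qed
        then show ?thesis using that by blast
      qed
      then show ?thesis using False *(2) by (intro exI[of _ "\<lambda>l. if l = i then a else b"]) auto
    qed
    then obtain \<delta> where \<delta>: "\<And>l. \<delta> l < N" "\<delta> i = a \<or> \<delta> i = Suc a mod N" "\<delta> j \<noteq> c" "\<delta> j \<noteq> Suc c mod N"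
      by blast
    obtain z where z: "z \<in> verts k"
        "\<And>i a. i < k \<Longrightarrow> a < N \<Longrightarrow> gap (i, a) z = 0 \<longleftrightarrow> \<delta> i = a \<or> \<delta> i = Suc a mod N"
      using vertex_with_digits[of \<delta>] \<delta>(1) by blast
    have "gap (i, a) z = 0" using z(2)[OF *(1,2)] \<delta>(2) by blast
    moreover have "gap (j, c) z \<noteq> 0" using z(2)[OF *(3,4)] \<delta>(3,4) by blast
    ultimately show ?thesis
      using z(1) gap_verts[OF z(1) *(3,4)] by (intro bexI[of _ z]) (simp_all del: gap.simps)
  qed
  have sub: "verts k \<subseteq> convex hull verts k" by (rule hull_subset)
  \<comment> \<open>a second edge of the same level supplies the points required for a single edge\<close>
  have other: "\<exists>c<N. c \<noteq> a" for a :: nat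
    using N(2) by (intro exI[of _ "if a = 0 then 1 else 0"]) auto
  have "card {F. F facet_of convex hull verts k} = card ({..<k} \<times> {..<N})"
  proof (rule card_facets_irredundant[OF _ convex_hull_verts])
    show "finite ({..<k} \<times> {..<N})" by simp
    show "convex hull verts k \<noteq> {}"
      using vertex_with_digits[of "\<lambda>_. 0"] N(2) by auto
    show "linear (\<lambda>z. gap j z - gap j 0)" for j by (rule linear_gap)
    show "\<exists>z\<in>convex hull verts k. gap j z > 0" if j: "j \<in> {..<k} \<times> {..<N}" for j
    proof -
      obtain i a where ia: "j = (i, a)" "i < k" "a < N" using j by auto
      obtain c where "c < N" "c \<noteq> a" using other by blast
      then show ?thesis using sep[of i c i a] ia sub by blast
    qed
    show "\<exists>z\<in>convex hull verts k. gap j z = 0" if j: "j \<in> {..<k} \<times> {..<N}" for j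
    proof -
      obtain i a where ia: "j = (i, a)" "i < k" "a < N" using j by auto
      obtain c where "c < N" "c \<noteq> a" using other by blast
      then show ?thesis using sep[of i a i c] ia sub by blast
    qed
    show "\<exists>z\<in>convex hull verts k. gap j z = 0 \<and> gap l z > 0"
      if jl: "j \<in> {..<k} \<times> {..<N}" "l \<in> {..<k} \<times> {..<N}" "j \<noteq> l" for j l
    proof -
      obtain i a i' a' where "j = (i, a)" "i < k" "a < N" "l = (i', a')" "i' < k" "a' < N"
        using jl by auto
      then show ?thesis using sep[of i a i' a'] jl(3) sub by blast
    qed
  qed
  then show ?thesis by (simp add: card_cartesian_product)
qed

section \<open>Vertices and their last coordinates\<close>

lemma X_image_verts: "X k ` verts k = real ` {..<N ^ k}"
proof (intro equalityI subsetI)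
  fix x assume "x \<in> X k ` verts k"
  then show "x \<in> real ` {..<N ^ k}"
    using digit_chain_less by (fastforce simp: verts_def)
next
  fix x assume "x \<in> real ` {..<N ^ k}"
  then obtain \<rho> where \<rho>: "digit_chain N k \<rho>" "x = real (\<rho> k)"
    using digit_chain_surj[of _ N k] by auto
  define z where "z = pt (\<lambda>i. real (\<rho> i)) (\<lambda>i. (real (\<rho> i))\<^sup>2)"
  have "X i z = real (\<rho> i) \<and> Y i z = (real (\<rho> i))\<^sup>2" if "i \<le> k" for i
    using that \<rho>(1) by (cases "i = 0") (auto simp: z_def X_pt Y_pt digit_chain_def)
  then have "z \<in> verts k" "X k z = x" using \<rho> by (auto simp: verts_def)
  then show "x \<in> X k ` verts k" by blast
qed

lemma Y_verts: "z \<in> verts k \<Longrightarrow> Y k z = (X k z)\<^sup>2"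
  by (auto simp: verts_def)

text \<open>The value at the top level determines the values at all lower levels of the
  code.\<close>

lemma inj_on_X_verts: "inj_on (X k) (verts k)"
proof (rule inj_onI)
  fix z w assume *: "z \<in> verts k" "w \<in> verts k" "X k z = X k w"
  obtain \<rho> where \<rho>: "digit_chain N k \<rho>" "\<And>i. i \<le> k \<Longrightarrow> X i z = real (\<rho> i) \<and> Y i z = (real (\<rho> i))\<^sup>2"
    using *(1) by (auto simp: verts_def)
  obtain \<sigma> where \<sigma>: "digit_chain N k \<sigma>" "\<And>i. i \<le> k \<Longrightarrow> X i w = real (\<sigma> i) \<and> Y i w = (real (\<sigma> i))\<^sup>2"
    using *(2) by (auto simp: verts_def)
  have "\<rho> k = \<sigma> k" using \<rho>(2)[of k] \<sigma>(2)[of k] *(3) by simp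
  then have "\<rho> i = \<sigma> i" if "i \<le> k" for i using digit_chain_inj[OF \<rho>(1) \<sigma>(1) _ that] by simp
  then show "z = w" using \<rho>(2) \<sigma>(2) by (intro coords_eqI) auto
qed

lemma finite_verts: "finite (verts k)"
  using finite_imageD[OF _ inj_on_X_verts] by (simp add: X_image_verts)

lemma card_verts: "card (verts k) = N ^ k"
  using card_image[OF inj_on_X_verts] by (simp add: X_image_verts card_image inj_on_def)

lemma extreme_points_hull_verts: "{v. v extreme_point_of convex hull verts k} = verts k"
proof -
  have "z \<notin> convex hull (verts k - {z})" if z: "z \<in> verts k" for z
  proof -
    \<comment> \<open>the tangent of the parabola at \<open>z\<close> separates \<open>z\<close> from the other vertices\<close>
    let ?H = "{w. Y k w - 2 * X k z * X k w > - (X k z)\<^sup>2}"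
    have "linear (\<lambda>w. Y k w - 2 * X k z * X k w)"
      by (rule linearI)
        (auto simp: algebra_simps linear_add[OF linear_X] linear_scale[OF linear_X]
          linear_add[OF linear_Y] linear_scale[OF linear_Y])
    then have "convex ((\<lambda>w. Y k w - 2 * X k z * X k w) -` {- (X k z)\<^sup>2<..})"
      by (intro convex_linear_vimage) auto
    then have "convex ?H" by (simp add: vimage_def)
    moreover have "verts k - {z} \<subseteq> ?H"
    proof
      fix w assume w: "w \<in> verts k - {z}"
      then have "X k w \<noteq> X k z" using inj_on_X_verts z by (auto dest: inj_onD)
      then have "(X k w - X k z)\<^sup>2 > 0" by simp
      then show "w \<in> ?H" using Y_verts[of w] w by (simp add: power2_eq_square algebra_simps)
    qed
    ultimately have "convex hull (verts k - {z}) \<subseteq> ?H" by (rule hull_minimal[rotated])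
    moreover have "z \<notin> ?H" using Y_verts[OF z] by (simp add: power2_eq_square)
    ultimately show ?thesis by blast
  qed
  then show ?thesis
    using extreme_point_of_convex_hull_convex_independent[OF finite_imp_compact[OF finite_verts]] by blast
qed

end

section \<open>Realisation in the standard coordinates and the planar projection\<close>

theorem theorem3p6:
  fixes n d M :: nat
  assumes "CARD('d::finite) = d"
    and "even d"
    and "2 * d dvd n"
    and "n div (2 * d) \<ge> 2"
    and "even (n div (2 * d))"
    and "M = (n div d) ^ (d div 2)"
  shows "\<exists>(P :: (real ^ 'd) set) (proj :: real ^ 'd \<Rightarrow> real ^ 2).
           polytope P \<and>
           card {F. F facet_of P} = n div 2 \<and>
           card {v. v extreme_point_of P} = M \<and>
           orthogonal_projection proj \<and>
           proj ` P = convex hull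
             {vector [real t / (real M - 1), (real t / (real M - 1))\<^sup>2 - real t / (real M - 1)] | t.
                t \<in> {0..M - 1}}"
proof -
  define k where "k = d div 2"
  define N where "N = n div d"
  have "d > 0" using assms(1) by (metis zero_less_card_finite)
  have d: "d = 2 * k" using assms(2) by (simp add: k_def)
  have "k > 0" using \<open>d > 0\<close> d by simp
  obtain m where m: "n = 2 * d * m" using assms(3) by blast
  have "n div (2 * d) = m" using m \<open>d > 0\<close> by simp
  then have "m \<ge> 2" using assms(4) by simp
  have N_eq: "N = 2 * m" using m \<open>d > 0\<close> by (simp add: N_def)
  have M: "M = N ^ k" using assms(6) by (simp add: N_def k_def)
  have "N ^ 1 \<le> N ^ k" using \<open>k > 0\<close> N_eq \<open>m \<ge> 2\<close> by (intro power_increasing) auto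
  then have "M \<ge> 4" using M N_eq \<open>m \<ge> 2\<close> by simp
  define c where "c = real M - 1"
  have "c > 0" using \<open>M \<ge> 4\<close> by (simp add: c_def)
  \<comment> \<open>The \<open>d = 2 * k\<close> coordinates are relabelled by a level and a flag,
    where \<open>True\<close> marks the first and \<open>False\<close> the second coordinate of a
    pair.\<close>
  have "card ({0<..k} \<times> (UNIV :: bool set)) = card (UNIV :: 'd set)"
    using assms(1) d by (simp add: card_cartesian_product)
  then obtain e :: "nat \<times> bool \<Rightarrow> 'd" where e: "bij_betw e ({0<..k} \<times> UNIV) UNIV"
    using finite_same_card_bij[of "{0<..k} \<times> (UNIV :: bool set)" "UNIV :: 'd set"] by auto
  define f where "f = inv_into ({0<..k} \<times> UNIV) e"
  have fe: "f (e (i, b)) = (i, b)" if "0 < i" "i \<le> k" for i b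
    unfolding f_def using e that by (intro bij_betw_inv_into_left) auto
  have ef: "\<exists>i b. 0 < i \<and> i \<le> k \<and> j = e (i, b)" for j
  proof -
    have "j \<in> e ` ({0<..k} \<times> UNIV)" using bij_betw_imp_surj_on[OF e] by simp
    then show ?thesis by auto
  qed
  \<comment> \<open>scaled so that \<open>(x, y) = (t, t\<^sup>2)\<close> becomes \<open>(t/c, (t/c)\<^sup>2 - t/c)\<close> in the standard coordinates\<close>
  define X where "X i z = (if i = 0 then 0 else c * z $ e (i, True))" for i and z :: "real^'d"
  define Y where "Y i z = (if i = 0 then 0 else c\<^sup>2 * (z $ e (i, False) + z $ e (i, True)))"
    for i and z :: "real^'d"
  define pt where "pt g h =
      (\<chi> j. case f j of (i, b) \<Rightarrow> if b then g i / c else h i / c\<^sup>2 - g i / c)" for g h :: "nat \<Rightarrow> real"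
  interpret level_coordinates N k X Y pt
  proof (rule level_coordinates.intro)
    show "even N" "N \<ge> 4" using N_eq \<open>m \<ge> 2\<close> by auto
    show "linear (X i)" for i
      by (auto intro!: linearI simp: X_def algebra_simps)
    show "linear (Y i)" for i
      by (auto intro!: linearI simp: Y_def algebra_simps)
    show "X 0 z = 0" for z by (simp add: X_def)
    show "Y 0 z = 0" for z by (simp add: Y_def)
    show "X i (pt g h) = g i" if "0 < i" "i \<le> k" for i g h
      using that \<open>c > 0\<close> by (simp add: X_def pt_def fe)
    show "Y i (pt g h) = h i" if "0 < i" "i \<le> k" for i g h
      using that \<open>c > 0\<close> by (simp add: Y_def pt_def fe)
    show "z = w" if *: "\<And>i. 0 < i \<Longrightarrow> i \<le> k \<Longrightarrow> X i z = X i w \<and> Y i z = Y i w" for z w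
    proof -
      have "z $ j = w $ j" for j
      proof -
        obtain i b where "0 < i" "i \<le> k" "j = e (i, b)" using ef by blast
        then show ?thesis using *[of i] \<open>c > 0\<close> by (cases b) (auto simp: X_def Y_def)
      qed
      then show ?thesis by (simp add: vec_eq_iff)
    qed
  qed
  define proj where "proj = (\<lambda>z::real^'d. vector [z $ e (k, True), z $ e (k, False)] :: real^2)"
  have "e (k, True) \<noteq> e (k, False)"
    using fe[of k True] fe[of k False] \<open>k > 0\<close> by auto
  then have "orthogonal_projection proj"
    unfolding proj_def by (rule orthogonal_projection_pair)
  have "linear proj"
    by (rule linearI) (auto simp: proj_def vec_eq_iff forall_2)
  let ?g = "\<lambda>x. vector [x / c, (x / c)\<^sup>2 - x / c] :: real^2"
  have "proj z = ?g (X k z)" if "z \<in> verts k" for z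
  proof -
    \<comment> \<open>This is \<open>Y k z = (X k z)\<^sup>2\<close> in the scaled coordinates;
      cancelling \<open>c\<^sup>2\<close> leaves the curve of the claim.\<close>
    have "c\<^sup>2 * (z $ e (k, False) + z $ e (k, True)) = (c * z $ e (k, True))\<^sup>2"
      using Y_verts[OF that] \<open>k > 0\<close> by (simp add: X_def Y_def)
    then have "z $ e (k, False) = (z $ e (k, True))\<^sup>2 - z $ e (k, True)"
      using \<open>c > 0\<close> by (simp add: power_mult_distrib eq_diff_eq)
    then show ?thesis
      using \<open>k > 0\<close> \<open>c > 0\<close> by (simp add: proj_def X_def)
  qed
  then have "proj ` verts k = ?g ` X k ` verts k"
    by (simp add: image_image)
  also have "\<dots> = {?g (real t) | t. t < M}"
    unfolding X_image_verts M by auto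
  \<comment> \<open>\<open>M\<close> is positive, so the truncated \<open>M - 1\<close> is the true
    upper end of the range.\<close>
  also have "\<dots> = {?g (real t) | t. t \<in> {0..M - 1}}"
    using \<open>M \<ge> 4\<close> by (intro Collect_cong ex_cong1) auto
  finally have "proj ` (convex hull verts k) = convex hull {?g (real t) | t. t \<in> {0..M - 1}}"
    using convex_hull_linear_image[OF \<open>linear proj\<close>, of "verts k"] by simp
  moreover have "polytope (convex hull verts k)"
    using finite_verts by (auto simp: polytope_def)
  moreover have "k * N = n div 2"
    using m d N_eq by simp
  ultimately show ?thesis
    using card_facets extreme_points_hull_verts card_verts M \<open>orthogonal_projection proj\<close>
    unfolding c_def by (intro exI[of _ "convex hull verts k"] exI[of _ proj]) simp
qed

end
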